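(* Let $(V,e)$ be an absolute matrix order unit space satisfying condition (T). For $p_1,p_2,q_1,q_2\in\mathcal{OP}_\infty(V)$ define $(p_1,q_1)\equiv(p_2,q_2)$ if and only if $p_1\oplus q_2\approx p_2\oplus q_1$. Then $\equiv$ is an equivalence relation on $\mathcal{OP}_\infty(V)\times\mathcal{OP}_\infty(V)$. Let $$K_0(V)=\{[(p,q)]:p,q\in\mathcal{OP}_\infty(V)\},$$ where $[(p,q)]$ is the equivalence class of $(p,q)$ for $\equiv$, and put $$[(p_1,q_1)]+[(p_2,q_2)]=[(p_1\oplus p_2,\,q_1\oplus q_2)]$$ for $p_1,p_2,q_1,q_2\in\mathcal{OP}_\infty(V)$. Then ($+$ is well defined and) $(K_0(V),+)$ is an abelian group.
   Context: **Absolute matrix order unit spaces.** $M_{m,n}(V)$ denotes $m\times n$ matrices over $V$, $M_{m,n}=M_{m,n}(\mathbb C)$ with operator norm, $v\oplus w$ is the block diagonal matrix, $0_n$ the zero of $M_n(V)$. A matrix ordered space is a complex vector space $V$ with involution (with $[v_{ij}]^*=[v_{ji}^*]$ on matrices) and cones $M_n(V)^+\subset M_n(V)_{sa}$ such that each $(M_n(V)_{sa},M_n(V)^+)$ is a real ordered vector space and $a^*va\in M_m(V)^+$ for $v\in M_n(V)^+$, $a\in M_{n,m}$. It is a matrix order unit space with order unit $e\in V^+$ if $e$ is an order unit for $V_{sa}$, $V^+$ is proper and every $M_n(V)^+$ is Archimedean (if $u\in M_n(V)^+$, $v\in M_n(V)_{sa}$ and $ku+v\in M_n(V)^+$ for all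 $k>0$, then $v\in M_n(V)^+$). Put $e^n=e\oplus\cdots\oplus e\in M_n(V)$ and $\|v\|_n=\inf\left\{k>0:\begin{bmatrix} ke^n & v \\ v^* & ke^n \end{bmatrix}\in M_{2n}(V)^+\right\}$. An absolutely ordered space $(X,X^+,|\cdot|)$ is a real ordered vector space with $|\cdot|:X\to X^+$ such that: $|v|=v$ for $v\in X^+$; $|v|\pm v\in X^+$; $|kv|=|k||v|$ for $k\in\mathbb R$; if $|u-v|=u+v$ and $0\le w\le v$ then $|u-w|=u+w$; if $|u-v|=u+v$ and $|u-w|=u+w$ then $\big|u-|v\pm w|\big|=u+|v\pm w|$. For $u,v\in X^+$ write $u\perp v$ if $|u-v|=u+v$. An absolute matrix order unit space is a matrix order unit space $(V,\{M_n(V)^+\},e)$ with maps $|\cdot|_{m,n}:M_{m,n}(V)\to M_n(V)^+$ ($|\cdot|_n:=|\cdot|_{n,n}$) such that: (1) each $(M_n(V)_{sa},M_n(V)^+,|\cdot|_n)$ is an absolutely ordered space; (2) $|\alpha v\beta|_{r,s}\le\|\alpha\|\,\big||v|_{m,n}\beta\big|_{n,s}$ for $v\in M_{m,n}(V)$, $\alpha\in M_{r,m}$, $\beta\in M_{n,s}$; (3) $|v\oplus w|_{m+r,n+s}=|v|_{m,n}\oplus|w|_{r,s}$; (4) $\perp=\perp^a_\infty$ on each $M_n(V)^+$, where $u\perp_\infty v$ means $\|k_1u+k_2v\|_n=\max\{\|k_1u\|_n,\|k_2v\|_n\}$ for all $k_1,k_2\in\mathbb R$, and $u\perp^a_\infty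 v$ means $u_1\perp_\infty v_1$ whenever $0\le u_1\le u$, $0\le v_1\le v$. **Projections and equivalence.** $p\in M_n(V)$ is an order projection if $p^*=p$ and $|2p-e^n|_n=e^n$; $\mathcal{OP}_n(V)$ is the set of these, $\mathcal{OP}(V)=\mathcal{OP}_1(V)$, and $\mathcal{OP}_\infty(V)=\bigcup_n\mathcal{OP}_n(V)$. $v\in M_{m,n}(V)$ is a partial isometry ($v\in\mathcal{PI}_{m,n}(V)$) if $|v|_{m,n}$ and $|v^*|_{n,m}$ are order projections. For $p\in\mathcal{OP}_m(V)$, $q\in\mathcal{OP}_n(V)$, $p\sim q$ means there is $v\in\mathcal{PI}_{m,n}(V)$ with $p=|v^*|_{n,m}$ and $q=|v|_{m,n}$. For $p,q\in\mathcal{OP}_\infty(V)$, $p\approx q$ means $p\oplus r\sim q\oplus r$ for some $r\in\mathcal{OP}_\infty(V)$. **Condition (T):** if $u\in\mathcal{PI}_{m,n}(V)$, $v\in\mathcal{PI}_{l,n}(V)$ and $|u|_{m,n}=|v|_{l,n}$, then there is $w\in\mathcal{PI}_{m,l}(V)$ with $|w^*|_{l,m}=|u^*|_{n,m}$ and $|w|_{m,l}=|v^*|_{n,l}$. *)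

theory Defs
  imports
    "HOL-Algebra.Group"
    "HOL-Analysis.L2_Norm"
    "Jordan_Normal_Form.Schur_Decomposition"
begin

section \<open>Absolutely ordered spaces\<close>

text \<open>
  A real ordered vector space is given by the carrier \<open>X\<close>, its positive cone \<open>P\<close> and the scalar
  multiplication \<open>sc\<close>. It is only used for \<open>X\<close> the self-adjoint \<open>n \<times> n\<close> matrices over a complex
  vector space with involution, which form a real vector space under the matrix operations;
  hence only the axioms of the cone are listed. Cones are not required to be proper.
\<close>

locale real_ordered_space =
  fixes sc :: "real \<Rightarrow> 'x::{plus,minus} \<Rightarrow> 'x"
    and X P :: "'x set"
  assumes cone_subset: "P \<subseteq> X"
    and cone_nonempty: "P \<noteq> {}"
    and cone_add: "u \<in> P \<Longrightarrow> v \<in> P \<Longrightarrow> u + v \<in> P"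
    and cone_scale: "u \<in> P \<Longrightarrow> 0 \<le> k \<Longrightarrow> sc k u \<in> P"

definition orth :: "('x::{plus,minus} \<Rightarrow> 'x) \<Rightarrow> 'x \<Rightarrow> 'x \<Rightarrow> bool" where
  "orth ab u v \<longleftrightarrow> ab (u - v) = u + v"

locale absolutely_ordered_space = real_ordered_space sc X P
  for sc :: "real \<Rightarrow> 'x::{plus,minus} \<Rightarrow> 'x" and X P :: "'x set" +
  fixes ab :: "'x \<Rightarrow> 'x"
  assumes abs_in_cone: "v \<in> X \<Longrightarrow> ab v \<in> P"
    and abs_of_pos: "v \<in> P \<Longrightarrow> ab v = v"
    and abs_dominates: "v \<in> X \<Longrightarrow> ab v + v \<in> P \<and> ab v - v \<in> P"
    and abs_scale: "v \<in> X \<Longrightarrow> ab (sc k v) = sc \<bar>k\<bar> (ab v)"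
    and orth_below: "\<lbrakk>u \<in> X; v \<in> X; w \<in> X; orth ab u v; w \<in> P; v - w \<in> P\<rbrakk> \<Longrightarrow> orth ab u w"
    and orth_abs: "\<lbrakk>u \<in> X; v \<in> X; w \<in> X; orth ab u v; orth ab u w\<rbrakk>
      \<Longrightarrow> orth ab u (ab (v + w)) \<and> orth ab u (ab (v - w))"


section \<open>Matrix order unit spaces\<close>

text \<open>
  The vector space \<open>V\<close> is the whole type \<open>'v\<close>. The space \<open>M\<^sub>m\<^sub>,\<^sub>n(V)\<close> is \<open>carrier_mat m n\<close>, and \<open>V\<close>
  itself is identified with \<open>M\<^sub>1(V)\<close>. Since a matrix determines its dimensions, the family of
  maps \<open>|\<cdot>|\<^sub>m\<^sub>,\<^sub>n\<close> is one function \<open>absval\<close>. All matrix sizes in the axioms and definitions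
  are positive.
\<close>

record 'v mat_order =
  scale :: "complex \<Rightarrow> 'v \<Rightarrow> 'v"
  star :: "'v \<Rightarrow> 'v"
  cone :: "nat \<Rightarrow> 'v mat set"

record 'v mat_order_unit = "'v mat_order" +
  ounit :: 'v

record 'v abs_mat_order_unit = "'v mat_order_unit" +
  absval :: "'v mat \<Rightarrow> 'v mat"

definition adj :: "('v, 'b) mat_order_scheme \<Rightarrow> 'v mat \<Rightarrow> 'v mat" where
  "adj V v = map_mat (star V) (transpose_mat v)"

definition rscale :: "('v, 'b) mat_order_scheme \<Rightarrow> real \<Rightarrow> 'v mat \<Rightarrow> 'v mat" where
  "rscale V k v = map_mat (scale V (complex_of_real k)) v"

definition lmul :: "('v::ab_group_add, 'b) mat_order_scheme \<Rightarrow> complex mat \<Rightarrow> 'v mat \<Rightarrow> 'v mat" where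
  "lmul V \<alpha> v = mat (dim_row \<alpha>) (dim_col v)
     (\<lambda>(i, j). \<Sum>k<dim_row v. scale V (\<alpha> $$ (i, k)) (v $$ (k, j)))"

definition rmul :: "('v::ab_group_add, 'b) mat_order_scheme \<Rightarrow> 'v mat \<Rightarrow> complex mat \<Rightarrow> 'v mat" where
  "rmul V v \<beta> = mat (dim_row v) (dim_col \<beta>)
     (\<lambda>(i, j). \<Sum>k<dim_col v. scale V (\<beta> $$ (k, j)) (v $$ (i, k)))"

definition dsum :: "'v::zero mat \<Rightarrow> 'v mat \<Rightarrow> 'v mat" (infixr "\<oplus>\<^sub>m" 65) where
  "v \<oplus>\<^sub>m w = four_block_mat v (0\<^sub>m (dim_row v) (dim_col w)) (0\<^sub>m (dim_row w) (dim_col v)) w"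

definition sa :: "('v, 'b) mat_order_scheme \<Rightarrow> nat \<Rightarrow> 'v mat set" where
  "sa V n = {v \<in> carrier_mat n n. adj V v = v}"

definition unit_mat :: "('v::zero, 'b) mat_order_unit_scheme \<Rightarrow> nat \<Rightarrow> 'v mat" where
  "unit_mat V n = mat n n (\<lambda>(i, j). if i = j then ounit V else 0)"

locale matrix_ordered_space =
  fixes V :: "('v::ab_group_add, 'b) mat_order_scheme"
  assumes complex_vector_space: "vector_space (scale V)"
    and star_add: "star V (x + y) = star V x + star V y"
    and star_scale: "star V (scale V c x) = scale V (cnj c) (star V x)"
    and star_star: "star V (star V x) = x"
    and ordered: "0 < n \<Longrightarrow> real_ordered_space (rscale V) (sa V n) (cone V n)"
    and cone_compress: "\<lbrakk>0 < n; 0 < m; v \<in> cone V n; a \<in> carrier_mat n m\<rbrakk>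
      \<Longrightarrow> rmul V (lmul V (mat_adjoint a) v) a \<in> cone V m"

locale matrix_order_unit_space = matrix_ordered_space V
  for V :: "('v::ab_group_add, 'b) mat_order_unit_scheme" +
  assumes unit_pos: "unit_mat V 1 \<in> cone V 1"
    and order_unit: "v \<in> sa V 1
      \<Longrightarrow> \<exists>k>0. rscale V k (unit_mat V 1) + v \<in> cone V 1 \<and> rscale V k (unit_mat V 1) - v \<in> cone V 1"
    and proper: "v \<in> cone V 1 \<Longrightarrow> - v \<in> cone V 1 \<Longrightarrow> v = 0\<^sub>m 1 1"
    and archimedean: "\<lbrakk>0 < n; u \<in> cone V n; v \<in> sa V n; \<forall>k>0. rscale V k u + v \<in> cone V n\<rbrakk>
      \<Longrightarrow> v \<in> cone V n"

definition mnorm :: "('v::zero, 'b) mat_order_unit_scheme \<Rightarrow> nat \<Rightarrow> 'v mat \<Rightarrow> real" where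
  "mnorm V n v = Inf {k. 0 < k \<and>
     four_block_mat (rscale V k (unit_mat V n)) v (adj V v) (rscale V k (unit_mat V n)) \<in> cone V (2 * n)}"


section \<open>Absolute matrix order unit spaces\<close>

definition op_norm :: "complex mat \<Rightarrow> real" where
  "op_norm \<alpha> = Sup {L2_set (\<lambda>i. cmod ((\<alpha> *\<^sub>v x) $ i)) {..<dim_row \<alpha>} | x.
     x \<in> carrier_vec (dim_col \<alpha>) \<and> L2_set (\<lambda>i. cmod (x $ i)) {..<dim_col \<alpha>} \<le> 1}"

definition orth_inf :: "('v::ab_group_add, 'b) mat_order_unit_scheme \<Rightarrow> nat \<Rightarrow> 'v mat \<Rightarrow> 'v mat \<Rightarrow> bool" where
  "orth_inf V n u v \<longleftrightarrow> (\<forall>k1 k2. mnorm V n (rscale V k1 u + rscale V k2 v)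
     = max (mnorm V n (rscale V k1 u)) (mnorm V n (rscale V k2 v)))"

definition abs_orth_inf :: "('v::ab_group_add, 'b) mat_order_unit_scheme \<Rightarrow> nat \<Rightarrow> 'v mat \<Rightarrow> 'v mat \<Rightarrow> bool" where
  "abs_orth_inf V n u v \<longleftrightarrow> (\<forall>u1\<in>cone V n. \<forall>v1\<in>cone V n.
     u - u1 \<in> cone V n \<longrightarrow> v - v1 \<in> cone V n \<longrightarrow> orth_inf V n u1 v1)"

locale absolute_matrix_order_unit_space = matrix_order_unit_space V
  for V :: "('v::ab_group_add, 'b) abs_mat_order_unit_scheme" +
  assumes absval_in_cone: "\<lbrakk>0 < m; 0 < n; v \<in> carrier_mat m n\<rbrakk> \<Longrightarrow> absval V v \<in> cone V n"
    and absolutely_ordered: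
      "0 < n \<Longrightarrow> absolutely_ordered_space (rscale V) (sa V n) (cone V n) (absval V)"
    and absval_mul: "\<lbrakk>0 < m; 0 < n; 0 < r; 0 < s;
        v \<in> carrier_mat m n; \<alpha> \<in> carrier_mat r m; \<beta> \<in> carrier_mat n s\<rbrakk>
      \<Longrightarrow> rscale V (op_norm \<alpha>) (absval V (rmul V (absval V v) \<beta>))
            - absval V (rmul V (lmul V \<alpha> v) \<beta>) \<in> cone V s"
    and absval_dsum: "\<lbrakk>0 < m; 0 < n; 0 < r; 0 < s; v \<in> carrier_mat m n; w \<in> carrier_mat r s\<rbrakk>
      \<Longrightarrow> absval V (v \<oplus>\<^sub>m w) = absval V v \<oplus>\<^sub>m absval V w"
    and orth_iff: "\<lbrakk>0 < n; u \<in> cone V n; v \<in> cone V n\<rbrakk>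
      \<Longrightarrow> orth (absval V) u v \<longleftrightarrow> abs_orth_inf V n u v"


section \<open>Order projections and the Grothendieck group\<close>

definition OP :: "('v::ab_group_add, 'b) abs_mat_order_unit_scheme \<Rightarrow> nat \<Rightarrow> 'v mat set" where
  "OP V n = {p \<in> carrier_mat n n. adj V p = p \<and> absval V (rscale V 2 p - unit_mat V n) = unit_mat V n}"

definition OP_inf :: "('v::ab_group_add, 'b) abs_mat_order_unit_scheme \<Rightarrow> 'v mat set" where
  "OP_inf V = (\<Union>n\<in>{0<..}. OP V n)"

definition PI :: "('v::ab_group_add, 'b) abs_mat_order_unit_scheme \<Rightarrow> nat \<Rightarrow> nat \<Rightarrow> 'v mat set" where
  "PI V m n = {v \<in> carrier_mat m n. absval V v \<in> OP V n \<and> absval V (adj V v) \<in> OP V m}"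

definition proj_equiv :: "('v::ab_group_add, 'b) abs_mat_order_unit_scheme \<Rightarrow> 'v mat \<Rightarrow> 'v mat \<Rightarrow> bool" where
  "proj_equiv V p q \<longleftrightarrow>
     (\<exists>v\<in>PI V (dim_row p) (dim_row q). p = absval V (adj V v) \<and> q = absval V v)"

definition stable_equiv :: "('v::ab_group_add, 'b) abs_mat_order_unit_scheme \<Rightarrow> 'v mat \<Rightarrow> 'v mat \<Rightarrow> bool" where
  "stable_equiv V p q \<longleftrightarrow> (\<exists>r\<in>OP_inf V. proj_equiv V (p \<oplus>\<^sub>m r) (q \<oplus>\<^sub>m r))"

definition condition_T :: "('v::ab_group_add, 'b) abs_mat_order_unit_scheme \<Rightarrow> bool" where
  "condition_T V \<longleftrightarrow> (\<forall>m>0. \<forall>n>0. \<forall>l>0. \<forall>u\<in>PI V m n. \<forall>v\<in>PI V l n.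
     absval V u = absval V v \<longrightarrow>
     (\<exists>w\<in>PI V m l. absval V (adj V w) = absval V (adj V u) \<and> absval V w = absval V (adj V v)))"

definition K0_rel :: "('v::ab_group_add, 'b) abs_mat_order_unit_scheme
    \<Rightarrow> (('v mat \<times> 'v mat) \<times> ('v mat \<times> 'v mat)) set" where
  "K0_rel V = {((p1, q1), (p2, q2)). p1 \<in> OP_inf V \<and> q1 \<in> OP_inf V \<and> p2 \<in> OP_inf V \<and> q2 \<in> OP_inf V \<and>
     stable_equiv V (p1 \<oplus>\<^sub>m q2) (p2 \<oplus>\<^sub>m q1)}"

text \<open>
  \<open>K\<^sub>0(V)\<close> as a \<open>HOL-Algebra\<close> structure: \<open>\<otimes>\<close> is the addition of classes. The sum of two classes
  is the union over all representatives of the class of the sum, which is a single class when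
  that class does not depend on the representatives. The matrix \<open>0\<^sub>m 1 1\<close> is the zero of \<open>V\<close>.
\<close>

definition K0 :: "('v::ab_group_add, 'b) abs_mat_order_unit_scheme \<Rightarrow> ('v mat \<times> 'v mat) set monoid" where
  "K0 V = \<lparr>carrier = (OP_inf V \<times> OP_inf V) // K0_rel V,
     monoid.mult = (\<lambda>A B. \<Union>(p1, q1)\<in>A. \<Union>(p2, q2)\<in>B. K0_rel V `` {(p1 \<oplus>\<^sub>m p2, q1 \<oplus>\<^sub>m q2)}),
     monoid.one = K0_rel V `` {(0\<^sub>m 1 1, 0\<^sub>m 1 1)}\<rparr>"

end

theory Submission
  imports Defs
begin

text \<open>
  Multiplying a matrix by a permutation matrix and by its inverse shows, through
  \<open>|\<alpha>v\<beta>| \<le> \<parallel>\<alpha>\<parallel> ||v|\<beta>|\<close> used in both directions, that permuting the rows of \<open>v\<close> does not change \<open>|v|\<close>.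
  Hence the antidiagonal block matrix of two order projections \<open>p\<close>, \<open>q\<close> is a partial isometry
  that witnesses \<open>p \<oplus> q \<sim> q \<oplus> p\<close>. Condition (T) is transitivity of \<open>\<sim>\<close>, so the classes of order
  projections form a commutative semigroup, and \<open>K\<^sub>0(V)\<close> is its Grothendieck group.
\<close>

section \<open>The Grothendieck group of a commutative semigroup\<close>

text \<open>
  The elements of \<open>M\<close> represent, through \<open>c\<close>, elements of a commutative semigroup; the
  addition of \<open>M\<close> itself need be neither associative nor commutative.
\<close>

locale grothendieck = abel_semigroup f for f :: "'b \<Rightarrow> 'b \<Rightarrow> 'b" +
  fixes M :: "'a set" and add :: "'a \<Rightarrow> 'a \<Rightarrow> 'a" and c :: "'a \<Rightarrow> 'b" and z :: 'a
  assumes add_closed: "p \<in> M \<Longrightarrow> q \<in> M \<Longrightarrow> add p q \<in> M"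
    and z_closed: "z \<in> M"
    and c_add: "p \<in> M \<Longrightarrow> q \<in> M \<Longrightarrow> c (add p q) = f (c p) (c q)"
begin

text \<open>A pair \<open>(p, q)\<close> stands for the formal difference \<open>c p - c q\<close>.
  The extra summand \<open>c r\<close> makes up for a semigroup without cancellation.\<close>

definition rel :: "(('a \<times> 'a) \<times> ('a \<times> 'a)) set" where
  "rel = {((p1, q1), (p2, q2)). p1 \<in> M \<and> q1 \<in> M \<and> p2 \<in> M \<and> q2 \<in> M \<and>
     (\<exists>r\<in>M. f (f (c p1) (c q2)) (c r) = f (f (c p2) (c q1)) (c r))}"

lemma relI:
  assumes "p1 \<in> M" "q1 \<in> M" "p2 \<in> M" "q2 \<in> M" "r \<in> M"
    and "f (f (c p1) (c q2)) (c r) = f (f (c p2) (c q1)) (c r)"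
  shows "((p1, q1), (p2, q2)) \<in> rel"
  using assms unfolding rel_def by blast

lemma relE:
  assumes "((p1, q1), (p2, q2)) \<in> rel"
  obtains r where "p1 \<in> M" "q1 \<in> M" "p2 \<in> M" "q2 \<in> M" "r \<in> M"
    and "f (f (c p1) (c q2)) (c r) = f (f (c p2) (c q1)) (c r)"
  using assms unfolding rel_def by blast

lemma equiv_rel: "equiv (M \<times> M) rel"
proof (rule equivI)
  show "rel \<subseteq> (M \<times> M) \<times> M \<times> M" unfolding rel_def by auto
  show "refl_on (M \<times> M) rel" by (auto simp: refl_on_def intro: relI z_closed)
  show "sym rel"
  proof (rule symI)
    fix x y assume "(x, y) \<in> rel"
    then show "(y, x) \<in> rel" by (cases x; cases y) (auto elim!: relE intro: relI)
  qed
  show "trans rel"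
  proof (rule transI)
    fix x y w assume xy: "(x, y) \<in> rel" and yw: "(y, w) \<in> rel"
    obtain p1 q1 p2 q2 p3 q3 where eqs: "x = (p1, q1)" "y = (p2, q2)" "w = (p3, q3)"
      by (cases x; cases y; cases w)
    from xy obtain r where M: "p1 \<in> M" "q1 \<in> M" "p2 \<in> M" "q2 \<in> M" "r \<in> M"
      and r: "f (f (c p1) (c q2)) (c r) = f (f (c p2) (c q1)) (c r)"
      unfolding eqs by (elim relE)
    from yw obtain s where N: "p3 \<in> M" "q3 \<in> M" "s \<in> M"
      and s: "f (f (c p2) (c q3)) (c s) = f (f (c p3) (c q2)) (c s)"
      unfolding eqs by (elim relE)
    \<comment> \<open>Adding the two equations leaves the middle terms \<open>c p2\<close> and
      \<open>c q2\<close> on both sides. They cannot be cancelled, so they join \<open>r\<close> and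
      \<open>s\<close> in the stabilising summand.\<close>
    let ?t = "add (add p2 q2) (add r s)"
    have t: "?t \<in> M" "c ?t = f (f (c p2) (c q2)) (f (c r) (c s))"
      using M N by (simp_all add: add_closed c_add)
    have "f (f (c p1) (c q3)) (c ?t)
        = f (f (f (c p1) (c q2)) (c r)) (f (f (c p2) (c q3)) (c s))"
      by (simp add: t ac_simps)
    also have "\<dots> = f (f (c p3) (c q1)) (c ?t)"
      unfolding r s by (simp add: t ac_simps)
    finally show "(x, w) \<in> rel" unfolding eqs using M N t by (intro relI[where r = ?t])
  qed
qed

text \<open>The two defining equations are added and regrouped; the stabilising summands add as
  well.\<close>

lemma rel_add:
  assumes "((p1, q1), (p1', q1')) \<in> rel" "((p2, q2), (p2', q2')) \<in> rel"
  shows "((add p1 p2, add q1 q2), (add p1' p2', add q1' q2')) \<in> rel"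
proof -
  from assms(1) obtain r where M: "p1 \<in> M" "q1 \<in> M" "p1' \<in> M" "q1' \<in> M" "r \<in> M"
    and r: "f (f (c p1) (c q1')) (c r) = f (f (c p1') (c q1)) (c r)"
    by (elim relE)
  from assms(2) obtain s where N: "p2 \<in> M" "q2 \<in> M" "p2' \<in> M" "q2' \<in> M" "s \<in> M"
    and s: "f (f (c p2) (c q2')) (c s) = f (f (c p2') (c q2)) (c s)"
    by (elim relE)
  have "f (f (f (c p1) (c p2)) (f (c q1') (c q2'))) (f (c r) (c s))
      = f (f (f (c p1) (c q1')) (c r)) (f (f (c p2) (c q2')) (c s))"
    by (simp add: ac_simps)
  also have "\<dots> = f (f (f (c p1') (c p2')) (f (c q1) (c q2))) (f (c r) (c s))"
    unfolding r s by (simp add: ac_simps)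
  finally show ?thesis
    using M N by (intro relI[where r = "add r s"]) (auto simp: add_closed c_add)
qed

abbreviation cl :: "'a \<Rightarrow> 'a \<Rightarrow> ('a \<times> 'a) set" where
  "cl p q \<equiv> rel `` {(p, q)}"

lemma cl_eqI: "((p1, q1), (p2, q2)) \<in> rel \<Longrightarrow> cl p1 q1 = cl p2 q2"
  by (rule equiv_class_eq[OF equiv_rel])

lemma congruent2_add:
  "congruent2 rel rel (\<lambda>(p1, q1) (p2, q2). cl (add p1 p2) (add q1 q2))"
  by (rule congruent2I') (auto intro!: cl_eqI rel_add)

definition group :: "('a \<times> 'a) set monoid" where
  "group = \<lparr>carrier = (M \<times> M) // rel,
     monoid.mult = (\<lambda>A B. \<Union>(p1, q1)\<in>A. \<Union>(p2, q2)\<in>B. cl (add p1 p2) (add q1 q2)),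
     monoid.one = cl z z\<rparr>"

text \<open>By \<open>congruent2_add\<close> every pair of representatives contributes the same
  class, so the union collapses to it.\<close>

lemma mult_cl:
  assumes "p1 \<in> M" "q1 \<in> M" "p2 \<in> M" "q2 \<in> M"
  shows "cl p1 q1 \<otimes>\<^bsub>group\<^esub> cl p2 q2 = cl (add p1 p2) (add q1 q2)"
  using UN_equiv_class2[OF equiv_rel equiv_rel congruent2_add, of "(p1, q1)" "(p2, q2)"] assms
  by (simp add: group_def case_prod_beta)

lemma carrier_cl: "A \<in> carrier group \<longleftrightarrow> (\<exists>p\<in>M. \<exists>q\<in>M. A = cl p q)"
  by (auto simp: group_def quotient_def)

lemma comm_group_group: "comm_group group"
proof (rule comm_groupI)
  have one: "\<one>\<^bsub>group\<^esub> = cl z z" by (simp add: group_def)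
  show "\<one>\<^bsub>group\<^esub> \<in> carrier group" unfolding carrier_cl one using z_closed by blast
  fix A assume "A \<in> carrier group"
  then obtain p1 q1 where A: "p1 \<in> M" "q1 \<in> M" "A = cl p1 q1" unfolding carrier_cl by blast
  \<comment> \<open>The summand \<open>c z\<close> occurs once on each side of the equation to be
    checked, so \<open>cl z z\<close> is neutral for any \<open>z\<close> in
    \<open>M\<close>.\<close>
  show "\<one>\<^bsub>group\<^esub> \<otimes>\<^bsub>group\<^esub> A = A"
    using A z_closed unfolding one
    by (auto simp: mult_cl c_add add_closed ac_simps intro!: cl_eqI relI[where r = z])
  \<comment> \<open>The inverse of a formal difference swaps its two components.\<close>
  have "cl q1 p1 \<otimes>\<^bsub>group\<^esub> A = \<one>\<^bsub>group\<^esub>"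
    using A z_closed unfolding one
    by (auto simp: mult_cl c_add add_closed ac_simps intro!: cl_eqI relI[where r = z])
  then show "\<exists>B\<in>carrier group. B \<otimes>\<^bsub>group\<^esub> A = \<one>\<^bsub>group\<^esub>"
    using A by (intro bexI[of _ "cl q1 p1"]) (auto simp: carrier_cl)
  fix B assume "B \<in> carrier group"
  then obtain p2 q2 where B: "p2 \<in> M" "q2 \<in> M" "B = cl p2 q2" unfolding carrier_cl by blast
  show "A \<otimes>\<^bsub>group\<^esub> B \<in> carrier group"
    unfolding carrier_cl using A B by (metis mult_cl add_closed)
  show "A \<otimes>\<^bsub>group\<^esub> B = B \<otimes>\<^bsub>group\<^esub> A"
    using A B z_closed
    by (auto simp: mult_cl c_add add_closed ac_simps intro!: cl_eqI relI[where r = z])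
  fix C assume "C \<in> carrier group"
  then obtain p3 q3 where C: "p3 \<in> M" "q3 \<in> M" "C = cl p3 q3" unfolding carrier_cl by blast
  show "A \<otimes>\<^bsub>group\<^esub> B \<otimes>\<^bsub>group\<^esub> C = A \<otimes>\<^bsub>group\<^esub> (B \<otimes>\<^bsub>group\<^esub> C)"
    using A B C z_closed
    by (auto simp: mult_cl c_add add_closed ac_simps intro!: cl_eqI relI[where r = z])
qed

end


section \<open>Direct sums of matrices\<close>

lemma dsum_carrier:
  "v \<in> carrier_mat m n \<Longrightarrow> w \<in> carrier_mat r s \<Longrightarrow> v \<oplus>\<^sub>m w \<in> carrier_mat (m + r) (n + s)"
  by (simp add: dsum_def)

lemma dsum_dims [simp]:
  "dim_row (v \<oplus>\<^sub>m w) = dim_row v + dim_row w" "dim_col (v \<oplus>\<^sub>m w) = dim_col v + dim_col w"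
  by (simp_all add: dsum_def)

lemma dsum_assoc: "(u \<oplus>\<^sub>m v) \<oplus>\<^sub>m w = u \<oplus>\<^sub>m (v \<oplus>\<^sub>m w)"
  unfolding dsum_def using assoc_four_block_mat[of u v w] by (simp add: Let_def)

lemma unit_mat_dsum: "unit_mat V m \<oplus>\<^sub>m unit_mat V n = unit_mat V (m + n)"
  by (rule eq_matI) (auto simp: dsum_def unit_mat_def)

lemma unit_mat_carrier [simp]: "unit_mat V n \<in> carrier_mat n n"
  by (simp add: unit_mat_def)

lemma adj_carrier: "v \<in> carrier_mat m n \<Longrightarrow> adj V v \<in> carrier_mat n m"
  by (simp add: adj_def)

lemma rscale_carrier: "v \<in> carrier_mat m n \<Longrightarrow> rscale V k v \<in> carrier_mat m n"
  by (simp add: rscale_def)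

text \<open>Permuting coordinates preserves the Euclidean norm, so the supremum over the unit ball
  is 1. It is attained at \<open>unit_vec n 0\<close>, a unit vector because
  \<open>0 < n\<close>.\<close>

lemma op_norm_permutation:
  assumes "0 < n" and \<sigma>: "\<sigma> permutes {..<n}"
  shows "op_norm (mat n n (\<lambda>(i, j). if j = \<sigma> i then 1 else 0)) = 1"
proof -
  let ?\<alpha> = "mat n n (\<lambda>(i, j). if j = \<sigma> i then 1 else 0) :: complex mat"
  have lt: "\<sigma> i < n" if "i < n" for i using permutes_in_image[OF \<sigma>, of i] that by simp
  have mv: "(?\<alpha> *\<^sub>v x) $ i = x $ \<sigma> i" if "x \<in> carrier_vec n" "i < n" for x i
    using that lt[of i] by (simp add: scalar_prod_def if_distrib[of "\<lambda>y. y * _"] cong: if_cong)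
  have iso: "L2_set (\<lambda>i. cmod ((?\<alpha> *\<^sub>v x) $ i)) {..<n} = L2_set (\<lambda>i. cmod (x $ i)) {..<n}"
    if "x \<in> carrier_vec n" for x
  proof -
    have "(\<Sum>i<n. (cmod ((?\<alpha> *\<^sub>v x) $ i))\<^sup>2) = (\<Sum>i<n. (cmod (x $ \<sigma> i))\<^sup>2)"
      by (rule sum.cong) (simp_all add: mv that del: index_mult_mat_vec)
    also have "\<dots> = (\<Sum>i<n. (cmod (x $ i))\<^sup>2)"
      using sum.permute[OF \<sigma>, of "\<lambda>i. (cmod (x $ i))\<^sup>2"] by (simp add: comp_def)
    finally show ?thesis by (simp only: L2_set_def)
  qed
  have unit: "L2_set (\<lambda>i. cmod (unit_vec n 0 $ i)) {..<n} = 1"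
  proof -
    have "(\<Sum>i<n. (cmod (unit_vec n 0 $ i))\<^sup>2) = (\<Sum>i<n. if i = 0 then 1 else 0)"
      by (rule sum.cong) auto
    then show ?thesis using assms(1) by (simp add: L2_set_def)
  qed
  show ?thesis unfolding op_norm_def
  proof (rule cSup_eq_maximum)
    show "1 \<in> {L2_set (\<lambda>i. cmod ((?\<alpha> *\<^sub>v x) $ i)) {..<dim_row ?\<alpha>} | x. x \<in> carrier_vec (dim_col ?\<alpha>)
        \<and> L2_set (\<lambda>i. cmod (x $ i)) {..<dim_col ?\<alpha>} \<le> 1}"
      using iso[of "unit_vec n 0"] unit
      by (auto simp del: index_mult_mat_vec index_unit_vec intro!: exI[of _ "unit_vec n 0"])
  qed (auto simp: iso simp del: index_mult_mat_vec)
qed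


section \<open>Order projections\<close>

sublocale matrix_ordered_space \<subseteq> vs: vector_space "scale V"
  by (rule complex_vector_space)

context matrix_ordered_space
begin

section \<open>Involution, real scaling and direct sums\<close>

lemma star_zero: "star V 0 = 0"
  using star_add[of 0 0] by simp

lemma star_diff: "star V (x - y) = star V x - star V y"
  using star_add[of "x - y" y] by simp

lemma adj_adj: "adj V (adj V v) = v"
  by (rule eq_matI) (auto simp: adj_def star_star)

lemma adj_dsum: "adj V (v \<oplus>\<^sub>m w) = adj V v \<oplus>\<^sub>m adj V w"
  by (rule eq_matI) (auto simp: adj_def dsum_def star_zero)

lemma rscale_dsum: "rscale V k (v \<oplus>\<^sub>m w) = rscale V k v \<oplus>\<^sub>m rscale V k w"
  by (rule eq_matI) (auto simp: rscale_def dsum_def)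

lemma rscale_one: "rscale V 1 v = v"
  by (rule eq_matI) (auto simp: rscale_def)

text \<open>Turns the two-sided axiom \<open>absval_mul\<close> into a statement on left
  multiplication alone.\<close>

lemma rmul_one: "v \<in> carrier_mat m n \<Longrightarrow> rmul V v (1\<^sub>m n) = v"
  by (rule eq_matI)
    (auto simp: rmul_def if_distrib[of "\<lambda>x. scale V x _"] cong: if_cong)

lemma dsum_diff:
  fixes v v' w w' :: "'v mat"
  assumes "v \<in> carrier_mat m n" "v' \<in> carrier_mat m n" "w \<in> carrier_mat r s" "w' \<in> carrier_mat r s"
  shows "(v \<oplus>\<^sub>m w) - (v' \<oplus>\<^sub>m w') = (v - v') \<oplus>\<^sub>m (w - w')"
  using assms by (intro eq_matI) (auto simp: dsum_def)

end

context absolute_matrix_order_unit_space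
begin

section \<open>Antisymmetry and self-adjointness from the cones\<close>

lemma cone_carrier: "0 < n \<Longrightarrow> v \<in> cone V n \<Longrightarrow> v \<in> carrier_mat n n"
  using real_ordered_space.cone_subset[OF ordered] by (auto simp: sa_def)

text \<open>
  The axioms only make \<open>cone V 1\<close> proper. For the larger cones, \<open>u - v\<close> and \<open>v - u\<close> both equal
  their absolute values, which agree since \<open>|-x| = |x|\<close>.
\<close>

lemma cone_antisym:
  assumes n: "0 < n" and u: "u \<in> carrier_mat n n" and v: "v \<in> carrier_mat n n"
    and uv: "u - v \<in> cone V n" and vu: "v - u \<in> cone V n"
  shows "u = v"
proof -
  interpret ao: absolutely_ordered_space "rscale V" "sa V n" "cone V n" "absval V"
    by (rule absolutely_ordered[OF n])
  have neg: "v - u = rscale V (-1) (u - v)"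
    using u v by (intro eq_matI) (auto simp: rscale_def)
  have "v - u = absval V (v - u)" using ao.abs_of_pos[OF vu] by simp
  also have "\<dots> = rscale V \<bar>-1\<bar> (absval V (u - v))"
    unfolding neg using uv ao.cone_subset by (intro ao.abs_scale) auto
  also have "\<dots> = u - v" by (simp add: rscale_one ao.abs_of_pos[OF uv])
  finally have eq: "v - u = u - v" .
  show ?thesis
  proof (rule eq_matI)
    fix i j assume "i < dim_row v" "j < dim_col v"
    then have "(v - u) $$ (i, j) = v $$ (i, j) - u $$ (i, j)"
      "(u - v) $$ (i, j) = u $$ (i, j) - v $$ (i, j)" using u v by auto
    then have "v $$ (i, j) - u $$ (i, j) = u $$ (i, j) - v $$ (i, j)"
      using eq by simp
    then have "(u $$ (i, j) - v $$ (i, j)) + (u $$ (i, j) - v $$ (i, j)) = 0"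
      by (metis diff_add_cancel diff_add_eq diff_self)
    \<comment> \<open>In a general abelian group \<open>x + x = 0\<close> does not give
      \<open>x = 0\<close>; the complex scaling permits division by two.\<close>
    then have "scale V 2 (u $$ (i, j) - v $$ (i, j)) = 0"
      using vs.scale_left_distrib[of 1 1] by simp
    then show "u $$ (i, j) = v $$ (i, j)" by simp
  qed (use u v in auto)
qed

text \<open>Cones consist of self-adjoint matrices, and \<open>ounit V\<close> is the only entry of
  the positive matrix \<open>unit_mat V 1\<close>.\<close>

lemma star_ounit: "star V (ounit V) = ounit V"
proof -
  have "unit_mat V 1 \<in> sa V 1"
    using unit_pos real_ordered_space.cone_subset[OF ordered, of 1] by auto
  then have "adj V (unit_mat V 1) $$ (0, 0) = unit_mat V 1 $$ (0, 0)" by (simp add: sa_def)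
  then show ?thesis by (simp add: adj_def unit_mat_def)
qed

section \<open>Positivity and direct sums of order projections\<close>

lemma OP_carrier: "p \<in> OP V n \<Longrightarrow> p \<in> carrier_mat n n"
  by (simp add: OP_def)

text \<open>For \<open>x = 2p - e\<close> the absolute value is \<open>e\<close>, so
  \<open>2p = |x| + x\<close> is positive, and halving keeps it positive.\<close>

lemma OP_in_cone:
  assumes n: "0 < n" and p: "p \<in> OP V n"
  shows "p \<in> cone V n"
proof -
  interpret ao: absolutely_ordered_space "rscale V" "sa V n" "cone V n" "absval V"
    by (rule absolutely_ordered[OF n])
  let ?x = "rscale V 2 p - unit_mat V n"
  note pc = OP_carrier[OF p]
  have pa: "star V (p $$ (j, i)) = p $$ (i, j)" if "i < n" "j < n" for i j
  proof -
    have "adj V p $$ (i, j) = p $$ (i, j)" using p by (simp add: OP_def)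
    then show ?thesis using pc that by (simp add: adj_def)
  qed
  have "adj V ?x = ?x"
    using pc by (intro eq_matI)
      (auto simp: adj_def rscale_def unit_mat_def star_diff star_scale pa star_ounit star_zero)
  then have "?x \<in> sa V n" by (simp add: sa_def minus_carrier_mat)
  then have "absval V ?x + ?x \<in> cone V n" using ao.abs_dominates by blast
  then have "unit_mat V n + ?x \<in> cone V n" using p by (simp add: OP_def)
  then have "rscale V (1/2) (unit_mat V n + ?x) \<in> cone V n" by (rule ao.cone_scale) simp
  also have "rscale V (1/2) (unit_mat V n + ?x) = p"
    using pc by (intro eq_matI) (auto simp: rscale_def unit_mat_def)
  finally show ?thesis .
qed

lemma absval_pos: "0 < n \<Longrightarrow> v \<in> cone V n \<Longrightarrow> absval V v = v"
  using absolutely_ordered_space.abs_of_pos[OF absolutely_ordered] .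

lemma absval_OP: "0 < n \<Longrightarrow> p \<in> OP V n \<Longrightarrow> absval V p = p"
  by (intro absval_pos OP_in_cone)

text \<open>Both scaling by 2 and the order unit split along the blocks, so
  \<open>absval_dsum\<close> treats each block separately.\<close>

lemma OP_dsum:
  assumes "0 < m" "0 < n" "p \<in> OP V m" "q \<in> OP V n"
  shows "p \<oplus>\<^sub>m q \<in> OP V (m + n)"
proof -
  have c: "p \<in> carrier_mat m m" "q \<in> carrier_mat n n" using assms OP_carrier by auto
  have "rscale V 2 (p \<oplus>\<^sub>m q) - unit_mat V (m + n)
      = (rscale V 2 p - unit_mat V m) \<oplus>\<^sub>m (rscale V 2 q - unit_mat V n)"
    unfolding unit_mat_dsum[symmetric] rscale_dsum
    by (rule dsum_diff) (rule c rscale_carrier unit_mat_carrier)+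
  moreover have "absval V \<dots> = unit_mat V m \<oplus>\<^sub>m unit_mat V n"
    using assms c by (subst absval_dsum[of m m n n]) (auto simp: OP_def minus_carrier_mat)
  ultimately show ?thesis
    using assms c by (auto simp: OP_def adj_dsum unit_mat_dsum dsum_carrier)
qed

text \<open>Here \<open>2p - e\<close> is \<open>-e\<close>, whose absolute value is
  \<open>e\<close>. This supplies the representative of the neutral class.\<close>

lemma zero_OP: "0\<^sub>m 1 1 \<in> OP V 1"
proof -
  interpret ao: absolutely_ordered_space "rscale V" "sa V 1" "cone V 1" "absval V"
    by (rule absolutely_ordered) simp
  have e: "unit_mat V 1 \<in> sa V 1" using unit_pos ao.cone_subset by auto
  have "rscale V 2 (0\<^sub>m 1 1) - unit_mat V 1 = rscale V (-1) (unit_mat V 1)"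
    by (intro eq_matI) (auto simp: rscale_def unit_mat_def)
  then have "absval V (rscale V 2 (0\<^sub>m 1 1) - unit_mat V 1) = unit_mat V 1"
    using ao.abs_scale[OF e, of "-1"] ao.abs_of_pos[OF unit_pos] by (simp add: rscale_one)
  moreover have "adj V (0\<^sub>m 1 1) = 0\<^sub>m 1 1"
    by (intro eq_matI) (auto simp: adj_def star_zero)
  ultimately show ?thesis by (simp add: OP_def)
qed

section \<open>Invariance of the absolute value under row permutations\<close>

lemma absval_permute_rows_le:
  assumes "0 < m" "0 < n" and v: "v \<in> carrier_mat m n" and \<sigma>: "\<sigma> permutes {..<m}"
  shows "absval V v - absval V (mat m n (\<lambda>(i, j). v $$ (\<sigma> i, j))) \<in> cone V n"
proof -
  let ?\<alpha> = "mat m m (\<lambda>(i, j). if j = \<sigma> i then 1 else 0) :: complex mat"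
  let ?w = "mat m n (\<lambda>(i, j). v $$ (\<sigma> i, j))"
  have lt: "\<sigma> i < m" if "i < m" for i using permutes_in_image[OF \<sigma>, of i] that by simp
  have lm: "lmul V ?\<alpha> v = ?w"
    using v lt by (intro eq_matI)
      (auto simp: lmul_def if_distrib[of "\<lambda>x. scale V x _"] cong: if_cong)
  have pos: "absval V v \<in> cone V n" using absval_in_cone assms by blast
  \<comment> \<open>With the identity as right factor and a left factor of norm 1, the axiom bounds
    \<open>absval V ?w\<close> by the absolute value of \<open>absval V v\<close>, which is
    \<open>absval V v\<close> itself by positivity.\<close>
  have "rscale V (op_norm ?\<alpha>) (absval V (rmul V (absval V v) (1\<^sub>m n)))
      - absval V (rmul V (lmul V ?\<alpha> v) (1\<^sub>m n)) \<in> cone V n"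
    using assms by (intro absval_mul[of m n m n]) auto
  then show ?thesis
    using assms rmul_one[of "absval V v" n n] rmul_one[of ?w m n] pos
    by (simp add: lm op_norm_permutation rscale_one cone_carrier absval_pos)
qed

text \<open>The inverse permutation recovers \<open>v\<close>, so the inequality holds in both
  directions and \<open>cone_antisym\<close> applies.\<close>

lemma absval_permute_rows:
  assumes "0 < m" "0 < n" and v: "v \<in> carrier_mat m n" and \<sigma>: "\<sigma> permutes {..<m}"
  shows "absval V (mat m n (\<lambda>(i, j). v $$ (\<sigma> i, j))) = absval V v"
proof -
  let ?w = "mat m n (\<lambda>(i, j). v $$ (\<sigma> i, j))"
  have lt: "inv_into UNIV \<sigma> i < m" if "i < m" for i
    using permutes_in_image[OF permutes_inv[OF \<sigma>], of i] that by simp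
  have undo: "mat m n (\<lambda>(i, j). ?w $$ (inv_into UNIV \<sigma> i, j)) = v"
    using v lt by (intro eq_matI) (auto simp: permutes_inverses[OF \<sigma>])
  have w: "?w \<in> carrier_mat m n" by simp
  show ?thesis
    using absval_permute_rows_le[OF assms(1,2) v \<sigma>]
      absval_permute_rows_le[OF assms(1,2) w permutes_inv[OF \<sigma>]]
      absval_in_cone[OF assms(1,2) v] absval_in_cone[OF assms(1,2) w] cone_carrier[OF assms(2)]
    unfolding undo by (intro cone_antisym[OF assms(2)]) auto
qed

lemma absval_antidiagonal:
  assumes "0 < m" "0 < n" and p: "p \<in> carrier_mat m m" and q: "q \<in> carrier_mat n n"
  shows "absval V (four_block_mat (0\<^sub>m n m) q p (0\<^sub>m m n)) = absval V p \<oplus>\<^sub>m absval V q"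
proof -
  \<comment> \<open>The first \<open>n\<close> rows are taken from the lower block of
    \<open>p \<oplus>\<^sub>m q\<close> and the remaining \<open>m\<close> rows from the upper one.
    Indices from \<open>m + n\<close> on are fixed, as \<open>permutes\<close> demands;
    \<open>?\<tau>\<close> is the inverse.\<close>
  let ?\<sigma> = "\<lambda>i. if i < n then i + m else if i < m + n then i - n else i"
  let ?\<tau> = "\<lambda>i. if i < m then i + n else if i < m + n then i - m else i"
  have "bij_betw ?\<sigma> {..<m + n} {..<m + n}"
    by (rule bij_betwI[where g = ?\<tau>]) auto
  then have \<sigma>: "?\<sigma> permutes {..<m + n}" by (rule bij_imp_permutes) auto
  have "four_block_mat (0\<^sub>m n m) q p (0\<^sub>m m n)
      = mat (m + n) (m + n) (\<lambda>(i, j). (p \<oplus>\<^sub>m q) $$ (?\<sigma> i, j))"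
    using p q by (intro eq_matI) (auto simp: dsum_def)
  also have "absval V \<dots> = absval V (p \<oplus>\<^sub>m q)"
    using assms by (intro absval_permute_rows \<sigma> dsum_carrier) auto
  also have "\<dots> = absval V p \<oplus>\<^sub>m absval V q" using absval_dsum assms by blast
  finally show ?thesis .
qed


section \<open>Equivalence of projections\<close>

lemma OP_infE:
  assumes "p \<in> OP_inf V"
  obtains n where "0 < n" "p \<in> OP V n" "p \<in> carrier_mat n n" "dim_row p = n"
  using assms by (auto simp: OP_inf_def OP_def)

lemma OP_infI: "0 < n \<Longrightarrow> p \<in> OP V n \<Longrightarrow> p \<in> OP_inf V"
  by (auto simp: OP_inf_def)

lemma OP_inf_dsum: "p \<in> OP_inf V \<Longrightarrow> q \<in> OP_inf V \<Longrightarrow> p \<oplus>\<^sub>m q \<in> OP_inf V"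
  by (elim OP_infE) (auto intro: OP_infI OP_dsum)

lemma proj_equivI:
  assumes "v \<in> carrier_mat m n" "p \<in> OP V m" "q \<in> OP V n" "absval V (adj V v) = p" "absval V v = q"
  shows "proj_equiv V p q"
  using assms by (auto simp: proj_equiv_def PI_def OP_def intro!: bexI[of _ v])

lemma proj_equivE:
  assumes "proj_equiv V p q"
  obtains v where "v \<in> PI V (dim_row p) (dim_row q)" "v \<in> carrier_mat (dim_row p) (dim_row q)"
    "absval V (adj V v) = p" "absval V v = q"
  using assms by (auto simp: proj_equiv_def PI_def)

text \<open>The projection is its own witness, being self-adjoint and equal to its absolute
  value.\<close>

lemma proj_equiv_refl:
  assumes "p \<in> OP_inf V" shows "proj_equiv V p p"
proof -
  obtain n where n: "0 < n" "p \<in> OP V n" using assms by (elim OP_infE)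
  then have "adj V p = p" by (simp add: OP_def)
  then show ?thesis using n by (intro proj_equivI[of p n n]) (auto simp: absval_OP OP_carrier)
qed

text \<open>The adjoint of a witness exchanges its initial and final projections.\<close>

lemma proj_equiv_sym:
  assumes "proj_equiv V p q" shows "proj_equiv V q p"
proof -
  obtain v where "v \<in> PI V (dim_row p) (dim_row q)" "absval V (adj V v) = p" "absval V v = q"
    using assms by (elim proj_equivE)
  then show ?thesis
    by (intro proj_equivI[of "adj V v" "dim_row q" "dim_row p"]) (auto simp: PI_def adj_adj adj_carrier)
qed

lemma proj_equiv_trans:
  assumes T: "condition_T V" and pqr: "p \<in> OP_inf V" "q \<in> OP_inf V" "r \<in> OP_inf V"
    and pq: "proj_equiv V p q" and qr: "proj_equiv V q r"
  shows "proj_equiv V p r"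
proof -
  obtain u where u: "u \<in> PI V (dim_row p) (dim_row q)" "absval V (adj V u) = p" "absval V u = q"
    using pq by (elim proj_equivE)
  \<comment> \<open>The second equivalence is reversed so that \<open>u\<close> and \<open>v\<close>
    share the absolute value \<open>q\<close>, as condition (T) requires.\<close>
  obtain v where v: "v \<in> PI V (dim_row r) (dim_row q)" "absval V (adj V v) = r" "absval V v = q"
    using proj_equiv_sym[OF qr] by (elim proj_equivE)
  have "0 < dim_row p" "0 < dim_row q" "0 < dim_row r" using pqr by (auto elim: OP_infE)
  then obtain w where "w \<in> PI V (dim_row p) (dim_row r)" "absval V (adj V w) = p" "absval V w = r"
    using T u v unfolding condition_T_def by metis
  then show ?thesis unfolding proj_equiv_def by blast
qed

text \<open>The direct sum of two witnesses is a witness, since both adjoint and absolute value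
  respect direct sums.\<close>

lemma proj_equiv_dsum:
  assumes M: "p \<in> OP_inf V" "q \<in> OP_inf V" "p' \<in> OP_inf V" "q' \<in> OP_inf V"
    and "proj_equiv V p q" and "proj_equiv V p' q'"
  shows "proj_equiv V (p \<oplus>\<^sub>m p') (q \<oplus>\<^sub>m q')"
proof -
  obtain m where m: "0 < m" "p \<in> OP V m" "dim_row p = m" using M by (elim OP_infE)
  obtain n where n: "0 < n" "q \<in> OP V n" "dim_row q = n" using M by (elim OP_infE)
  obtain m' where m': "0 < m'" "p' \<in> OP V m'" "dim_row p' = m'" using M by (elim OP_infE)
  obtain n' where n': "0 < n'" "q' \<in> OP V n'" "dim_row q' = n'" using M by (elim OP_infE)
  obtain v where v: "v \<in> carrier_mat m n" "absval V (adj V v) = p" "absval V v = q"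
    using \<open>proj_equiv V p q\<close> m n by (metis proj_equivE)
  obtain w where w: "w \<in> carrier_mat m' n'" "absval V (adj V w) = p'" "absval V w = q'"
    using \<open>proj_equiv V p' q'\<close> m' n' by (metis proj_equivE)
  have "absval V (v \<oplus>\<^sub>m w) = q \<oplus>\<^sub>m q'"
    using absval_dsum[of m n m' n' v w] m n m' n' v w by simp
  moreover have "absval V (adj V (v \<oplus>\<^sub>m w)) = p \<oplus>\<^sub>m p'"
    using absval_dsum[of n m n' m' "adj V v" "adj V w"] m n m' n' v w
    by (simp add: adj_dsum adj_carrier)
  ultimately show ?thesis
    using m n m' n' v w
    by (intro proj_equivI[of "v \<oplus>\<^sub>m w" "m + m'" "n + n'"]) (auto intro: OP_dsum dsum_carrier)
qed

text \<open>The adjoint of the antidiagonal witness is again antidiagonal with the two blocks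
  exchanged, so \<open>absval_antidiagonal\<close> computes both absolute values.\<close>

lemma proj_equiv_dsum_commute:
  assumes "p \<in> OP_inf V" "q \<in> OP_inf V"
  shows "proj_equiv V (q \<oplus>\<^sub>m p) (p \<oplus>\<^sub>m q)"
proof -
  obtain m where m: "0 < m" "p \<in> OP V m" "p \<in> carrier_mat m m" using assms by (elim OP_infE)
  obtain n where n: "0 < n" "q \<in> OP V n" "q \<in> carrier_mat n n" using assms by (elim OP_infE)
  let ?v = "four_block_mat (0\<^sub>m n m) q p (0\<^sub>m m n)"
  have "adj V ?v = four_block_mat (0\<^sub>m m n) (adj V p) (adj V q) (0\<^sub>m n m)"
    using m n by (intro eq_matI) (auto simp: adj_def star_zero)
  also have "\<dots> = four_block_mat (0\<^sub>m m n) p q (0\<^sub>m n m)"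
    using m n by (simp add: OP_def)
  finally have a: "absval V (adj V ?v) = q \<oplus>\<^sub>m p"
    using m n by (simp add: absval_antidiagonal absval_OP)
  have b: "absval V ?v = p \<oplus>\<^sub>m q"
    using m n by (simp add: absval_antidiagonal absval_OP)
  have "?v \<in> carrier_mat (n + m) (m + n)"
    using m n by (metis four_block_carrier_mat zero_carrier_mat)
  then show ?thesis
    using m n a b by (intro proj_equivI[of ?v "n + m" "m + n"] OP_dsum) auto
qed


section \<open>The group of stable classes\<close>

definition proj_class :: "'v mat \<Rightarrow> 'v mat set" where
  "proj_class p = {q \<in> OP_inf V. proj_equiv V q p}"

text \<open>
  Intersecting with \<open>OP_inf V\<close> makes the addition of classes associative and commutative on
  arbitrary sets of matrices, so that it is an abelian semigroup on a whole type.
\<close>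

definition class_add :: "'v mat set \<Rightarrow> 'v mat set \<Rightarrow> 'v mat set" where
  "class_add A B = {q \<in> OP_inf V. \<exists>a\<in>A \<inter> OP_inf V. \<exists>b\<in>B \<inter> OP_inf V. proj_equiv V q (a \<oplus>\<^sub>m b)}"

context
  assumes T: "condition_T V"
begin

section \<open>The commutative semigroup of classes under condition (T)\<close>

lemma proj_equiv_iff_right:
  assumes "p \<in> OP_inf V" "q \<in> OP_inf V" "r \<in> OP_inf V" "proj_equiv V p q"
  shows "proj_equiv V r p \<longleftrightarrow> proj_equiv V r q"
  using assms proj_equiv_trans[OF T, of r p q] proj_equiv_trans[OF T, of r q p]
    proj_equiv_sym[of p q] by blast

lemma proj_class_eq_iff:
  assumes "p \<in> OP_inf V" "q \<in> OP_inf V"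
  shows "proj_class p = proj_class q \<longleftrightarrow> proj_equiv V p q"
proof
  assume "proj_class p = proj_class q"
  moreover have "p \<in> proj_class p" using assms(1) by (simp add: proj_class_def proj_equiv_refl)
  ultimately show "proj_equiv V p q" by (simp add: proj_class_def)
next
  assume "proj_equiv V p q"
  then show "proj_class p = proj_class q"
    using proj_equiv_iff_right[OF assms] by (auto simp: proj_class_def)
qed

lemma class_add_commute: "class_add A B = class_add B A"
proof -
  have "class_add A B \<subseteq> class_add B A" for A B
  proof
    fix q assume "q \<in> class_add A B"
    then obtain a b where q: "q \<in> OP_inf V" "a \<in> A \<inter> OP_inf V" "b \<in> B \<inter> OP_inf V"
      "proj_equiv V q (a \<oplus>\<^sub>m b)" unfolding class_add_def by auto
    then have "proj_equiv V q (b \<oplus>\<^sub>m a)"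
      using proj_equiv_iff_right[of "a \<oplus>\<^sub>m b" "b \<oplus>\<^sub>m a" q] proj_equiv_dsum_commute[of b a]
      by (simp add: OP_inf_dsum)
    then show "q \<in> class_add B A" unfolding class_add_def using q by auto
  qed
  then show ?thesis by (intro equalityI)
qed

text \<open>Eliminates the intermediate projection \<open>x\<close> of a nested sum:
  \<open>x\<close> is equivalent to \<open>a \<oplus>\<^sub>m b\<close>, and adding \<open>d\<close>
  preserves this. Conversely \<open>a \<oplus>\<^sub>m b\<close> itself can serve as
  \<open>x\<close>.\<close>

lemma class_add_assoc_left:
  "class_add (class_add A B) C = {q \<in> OP_inf V. \<exists>a\<in>A \<inter> OP_inf V. \<exists>b\<in>B \<inter> OP_inf V. \<exists>d\<in>C \<inter> OP_inf V.
     proj_equiv V q ((a \<oplus>\<^sub>m b) \<oplus>\<^sub>m d)}" (is "_ = ?R")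
proof (intro equalityI subsetI)
  fix q assume "q \<in> class_add (class_add A B) C"
  then obtain x d a b where q: "q \<in> OP_inf V" "x \<in> OP_inf V" "d \<in> C \<inter> OP_inf V"
    "proj_equiv V q (x \<oplus>\<^sub>m d)" "a \<in> A \<inter> OP_inf V" "b \<in> B \<inter> OP_inf V" "proj_equiv V x (a \<oplus>\<^sub>m b)"
    unfolding class_add_def by auto
  then have "proj_equiv V (x \<oplus>\<^sub>m d) ((a \<oplus>\<^sub>m b) \<oplus>\<^sub>m d)"
    by (intro proj_equiv_dsum proj_equiv_refl OP_inf_dsum) auto
  then have "proj_equiv V q ((a \<oplus>\<^sub>m b) \<oplus>\<^sub>m d)"
    using proj_equiv_iff_right[of "x \<oplus>\<^sub>m d" "(a \<oplus>\<^sub>m b) \<oplus>\<^sub>m d" q] q by (simp add: OP_inf_dsum)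
  then show "q \<in> ?R" using q by auto
next
  fix q assume "q \<in> ?R"
  then obtain a b d where q: "q \<in> OP_inf V" "a \<in> A \<inter> OP_inf V" "b \<in> B \<inter> OP_inf V" "d \<in> C \<inter> OP_inf V"
    "proj_equiv V q ((a \<oplus>\<^sub>m b) \<oplus>\<^sub>m d)" by auto
  then have "a \<oplus>\<^sub>m b \<in> class_add A B \<inter> OP_inf V"
    unfolding class_add_def by (auto intro: OP_inf_dsum proj_equiv_refl)
  then show "q \<in> class_add (class_add A B) C"
    unfolding class_add_def[of "class_add A B"] using q by auto
qed

text \<open>Two commutations turn the right-nested sum into a left-nested one with the order
  reversed, so \<open>class_add_assoc_left\<close> describes both sides and only the order of three
  summands has to be compared.\<close>

lemma class_add_assoc: "class_add (class_add A B) C = class_add A (class_add B C)"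
proof -
  have rev: "proj_equiv V q ((d \<oplus>\<^sub>m b) \<oplus>\<^sub>m a) \<longleftrightarrow> proj_equiv V q ((a \<oplus>\<^sub>m b) \<oplus>\<^sub>m d)"
    if "a \<in> OP_inf V" "b \<in> OP_inf V" "d \<in> OP_inf V" "q \<in> OP_inf V" for a b d q
  proof -
    have "proj_equiv V (d \<oplus>\<^sub>m (b \<oplus>\<^sub>m a)) (d \<oplus>\<^sub>m (a \<oplus>\<^sub>m b))"
      using that by (intro proj_equiv_dsum proj_equiv_refl proj_equiv_dsum_commute OP_inf_dsum)
    moreover have "proj_equiv V (d \<oplus>\<^sub>m (a \<oplus>\<^sub>m b)) ((a \<oplus>\<^sub>m b) \<oplus>\<^sub>m d)"
      using that by (intro proj_equiv_dsum_commute OP_inf_dsum)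
    ultimately show ?thesis
      using that proj_equiv_iff_right[of "d \<oplus>\<^sub>m (b \<oplus>\<^sub>m a)" "d \<oplus>\<^sub>m (a \<oplus>\<^sub>m b)" q]
        proj_equiv_iff_right[of "d \<oplus>\<^sub>m (a \<oplus>\<^sub>m b)" "(a \<oplus>\<^sub>m b) \<oplus>\<^sub>m d" q]
      by (simp add: OP_inf_dsum dsum_assoc)
  qed
  have "class_add A (class_add B C) = class_add (class_add C B) A"
    by (subst class_add_commute, subst (2) class_add_commute) (rule refl)
  also have "class_add (class_add C B) A = class_add (class_add A B) C"
    unfolding class_add_assoc_left
  proof (intro Collect_cong conj_cong refl)
    fix q assume q: "q \<in> OP_inf V"
    have "(\<exists>d\<in>C \<inter> OP_inf V. \<exists>b\<in>B \<inter> OP_inf V. \<exists>a\<in>A \<inter> OP_inf V. proj_equiv V q ((d \<oplus>\<^sub>m b) \<oplus>\<^sub>m a))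
      \<longleftrightarrow> (\<exists>d\<in>C \<inter> OP_inf V. \<exists>b\<in>B \<inter> OP_inf V. \<exists>a\<in>A \<inter> OP_inf V. proj_equiv V q ((a \<oplus>\<^sub>m b) \<oplus>\<^sub>m d))"
      by (intro bex_cong refl) (simp add: rev q)
    also have "\<dots> \<longleftrightarrow> (\<exists>a\<in>A \<inter> OP_inf V. \<exists>b\<in>B \<inter> OP_inf V. \<exists>d\<in>C \<inter> OP_inf V. proj_equiv V q ((a \<oplus>\<^sub>m b) \<oplus>\<^sub>m d))"
      by blast
    finally show "(\<exists>d\<in>C \<inter> OP_inf V. \<exists>b\<in>B \<inter> OP_inf V. \<exists>a\<in>A \<inter> OP_inf V. proj_equiv V q ((d \<oplus>\<^sub>m b) \<oplus>\<^sub>m a))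
      \<longleftrightarrow> (\<exists>a\<in>A \<inter> OP_inf V. \<exists>b\<in>B \<inter> OP_inf V. \<exists>d\<in>C \<inter> OP_inf V. proj_equiv V q ((a \<oplus>\<^sub>m b) \<oplus>\<^sub>m d))" .
  qed
  finally show ?thesis by (rule sym)
qed

text \<open>One inclusion takes \<open>p\<close> and \<open>q\<close> as representatives of their
  own classes; the other replaces arbitrary representatives by them through
  \<open>proj_equiv_dsum\<close>.\<close>

lemma proj_class_dsum:
  assumes "p \<in> OP_inf V" "q \<in> OP_inf V"
  shows "proj_class (p \<oplus>\<^sub>m q) = class_add (proj_class p) (proj_class q)"
proof (intro equalityI subsetI)
  fix x assume "x \<in> proj_class (p \<oplus>\<^sub>m q)"
  moreover have "p \<in> proj_class p \<inter> OP_inf V" "q \<in> proj_class q \<inter> OP_inf V"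
    using assms by (auto simp: proj_class_def proj_equiv_refl)
  ultimately show "x \<in> class_add (proj_class p) (proj_class q)"
    unfolding class_add_def proj_class_def[of "p \<oplus>\<^sub>m q"] by auto
next
  fix x assume "x \<in> class_add (proj_class p) (proj_class q)"
  then obtain a b where x: "x \<in> OP_inf V" "a \<in> OP_inf V" "b \<in> OP_inf V"
    "proj_equiv V a p" "proj_equiv V b q" "proj_equiv V x (a \<oplus>\<^sub>m b)"
    unfolding class_add_def proj_class_def by auto
  then have "proj_equiv V x (p \<oplus>\<^sub>m q)"
    using proj_equiv_iff_right[of "a \<oplus>\<^sub>m b" "p \<oplus>\<^sub>m q" x] proj_equiv_dsum[of a p b q] assms
    by (simp add: OP_inf_dsum)
  then show "x \<in> proj_class (p \<oplus>\<^sub>m q)" using x by (simp add: proj_class_def)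
qed

section \<open>Identification with the Grothendieck group\<close>

lemma grothendieck: "grothendieck class_add (OP_inf V) (\<oplus>\<^sub>m) proj_class (0\<^sub>m 1 1)"
  by unfold_locales
    (rule class_add_assoc class_add_commute OP_inf_dsum proj_class_dsum OP_infI[OF _ zero_OP]
      | assumption | simp)+

text \<open>Equivalence of the sums with \<open>r\<close> is equality of their classes by
  \<open>proj_class_eq_iff\<close>, and \<open>proj_class_dsum\<close> splits these classes into
  three summands. The stabilising projection is the same \<open>r\<close> on both sides.\<close>

lemma K0_rel_eq: "K0_rel V = grothendieck.rel class_add (OP_inf V) proj_class"
proof -
  interpret G: grothendieck class_add "OP_inf V" "(\<oplus>\<^sub>m)" proj_class "0\<^sub>m 1 1"
    by (rule grothendieck)
  have "stable_equiv V (p1 \<oplus>\<^sub>m q2) (p2 \<oplus>\<^sub>m q1) \<longleftrightarrow>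
      (\<exists>r\<in>OP_inf V. class_add (class_add (proj_class p1) (proj_class q2)) (proj_class r)
        = class_add (class_add (proj_class p2) (proj_class q1)) (proj_class r))"
    if "p1 \<in> OP_inf V" "q1 \<in> OP_inf V" "p2 \<in> OP_inf V" "q2 \<in> OP_inf V" for p1 q1 p2 q2
    using that unfolding stable_equiv_def
    by (intro bex_cong refl) (simp flip: proj_class_dsum proj_class_eq_iff add: OP_inf_dsum)
  then show ?thesis unfolding K0_rel_def G.rel_def by (simp cong: conj_cong)
qed

lemma K0_eq: "K0 V = grothendieck.group class_add (OP_inf V) (\<oplus>\<^sub>m) proj_class (0\<^sub>m 1 1)"
  unfolding K0_def grothendieck.group_def[OF grothendieck] K0_rel_eq by simp

end

end

theorem theorem4p8:
  fixes V :: "('v::ab_group_add, 'b) abs_mat_order_unit_scheme"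
  assumes "absolute_matrix_order_unit_space V"
    and "condition_T V"
  shows "equiv (OP_inf V \<times> OP_inf V) (K0_rel V)
    \<and> congruent2 (K0_rel V) (K0_rel V)
        (\<lambda>(p1, q1) (p2, q2). K0_rel V `` {(p1 \<oplus>\<^sub>m p2, q1 \<oplus>\<^sub>m q2)})
    \<and> (\<forall>p1\<in>OP_inf V. \<forall>q1\<in>OP_inf V. \<forall>p2\<in>OP_inf V. \<forall>q2\<in>OP_inf V.
        p1 \<oplus>\<^sub>m p2 \<in> OP_inf V \<and> q1 \<oplus>\<^sub>m q2 \<in> OP_inf V
        \<and> (K0_rel V `` {(p1, q1)}) \<otimes>\<^bsub>K0 V\<^esub> (K0_rel V `` {(p2, q2)})
            = K0_rel V `` {(p1 \<oplus>\<^sub>m p2, q1 \<oplus>\<^sub>m q2)})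
    \<and> comm_group (K0 V)"
proof -
  interpret absolute_matrix_order_unit_space V by (rule assms(1))
  interpret G: grothendieck class_add "OP_inf V" "(\<oplus>\<^sub>m)" proj_class "0\<^sub>m 1 1"
    by (rule grothendieck[OF assms(2)])
  show ?thesis
    \<comment> \<open>Once \<open>K0 V\<close> and \<open>K0_rel V\<close> are rewritten, every
      conjunct is a fact about the abstract construction \<open>G\<close>.\<close>
    unfolding K0_eq[OF assms(2)] K0_rel_eq[OF assms(2)]
    by (intro conjI ballI G.equiv_rel G.congruent2_add G.comm_group_group G.mult_cl G.add_closed)
qed

end
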